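(* Let $T,d_w\ge1$ be integers and let $w_1,\dots,w_T\in\mathbb{R}^{d_w}$ be fixed known vectors. Suppose the random outcome vector $Y=(Y_1,\dots,Y_T)'\in\{0,1\}^T$, given a fixed initial condition $Y^0=y^0$ and a fixed effect $A\in\mathbb{R}^{d_w}$, satisfies $$\Pr(Y=y\mid Y^0=y^0,A)=\prod_{t=1}^T\frac{\left[\exp\left(\pi_t(y^{t-1},\theta)+w_t'A\right)\right]^{y_t}}{1+\exp\left(\pi_t(y^{t-1},\theta)+w_t'A\right)},\qquad y\in\{0,1\}^T,$$ where $y^{t-1}=(y_{t-1},y_{t-2},\dots,y_1,y^0)$ is the outcome history (equal to $y^0$ for $t=1$), $\theta$ is a parameter, and each $\pi_t(\cdot,\cdot)$ is a known real-valued function. Let $y,\tilde y\in\{0,1\}^T$ be any two outcome sequences, and write $y^{t-1}=(y_{t-1},\dots,y_1,y^0)$ and $\tilde y^{\,t-1}=(\tilde y_{t-1},\dots,\tilde y_1,y^0)$ (with the same initial condition $y^0$). Assume that: (i) $\sum_{t=1}^T w_ty_t=\sum_{t=1}^T w_t\tilde y_t$; (ii) the list $\big[(w_t,\pi_t(y^{t-1},\theta)) : t=2,\dots,T\big]$ is a permutation of the list $\big[(w_t,\pi_t(\tilde y^{\,t-1},\theta)) : t=2,\dots,T\big]$. Then $$\frac{\Pr(Y=y\mid Y^0=y^0,A)}{\Pr(Y=\tilde y\mid Y^0=y^0,A)}=\exp\left\{\sum_{t=1}^T\left[y_t\,\pi_t(y^{t-1},\theta)-\tilde y_t\,\pi_t(\tilde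 y^{\,t-1},\theta)\right]\right\},$$ which does not depend on $A$.
   Context: "Permutation" means that the two lists of pairs, each of length $T-1$, coincide as multisets. *)

theory Defs
  imports "HOL-Probability.Probability" "HOL-Library.Multiset"
begin

text \<open>
  A binary outcome sequence is a function on the periods \<open>1, \<dots>, T\<close> with values in \<open>{0, 1}\<close>; its
  values at other indices play no role.  The initial condition has an arbitrary type \<open>'z\<close>, so it may
  consist of several pre-sample outcomes or covariates.
\<close>

definition binary_seqs :: "nat \<Rightarrow> (nat \<Rightarrow> nat) set" where
  "binary_seqs T = {1..T} \<rightarrow> {0, 1}"

text \<open>\<open>history y0 y s\<close> is \<open>(y\<^sub>s, \<dots>, y\<^sub>1, y0)\<close>, most recent outcome first, and \<open>([], y0)\<close> if \<open>s = 0\<close>.\<close>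

definition history :: "'z \<Rightarrow> (nat \<Rightarrow> nat) \<Rightarrow> nat \<Rightarrow> nat list \<times> 'z" where
  "history y0 y s = (map y (rev [1..<Suc s]), y0)"

definition logit_index ::
  "(nat \<Rightarrow> nat list \<times> 'z \<Rightarrow> 'p \<Rightarrow> real) \<Rightarrow> 'p \<Rightarrow> 'z \<Rightarrow> (nat \<Rightarrow> nat) \<Rightarrow> nat \<Rightarrow> real" where
  "logit_index \<pi> \<theta> y0 y t = \<pi> t (history y0 y (t - 1)) \<theta>"

text \<open>
  The measure \<open>M y0 A\<close> is the conditional law on the sample space given the initial condition \<open>y0\<close>
  and the fixed effect \<open>A\<close>, so that the probability below is \<open>Pr(Y = y | Y\<^sup>0 = y0, A)\<close>.
\<close>

definition outcome_prob ::
  "('z \<Rightarrow> 'a \<Rightarrow> 'w measure) \<Rightarrow> (nat \<Rightarrow> 'w \<Rightarrow> nat) \<Rightarrow> nat \<Rightarrow> 'z \<Rightarrow> 'a \<Rightarrow> (nat \<Rightarrow> nat) \<Rightarrow> real" where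
  "outcome_prob M Y T y0 A y = \<P>(\<omega> in M y0 A. \<forall>t\<in>{1..T}. Y t \<omega> = y t)"

end

theory Submission
  imports Defs
begin

text \<open>
  Every outcome probability is the exponential of
  \<open>\<Sum>\<^sub>t y\<^sub>t \<pi>\<^sub>t + (\<Sum>\<^sub>t y\<^sub>t w\<^sub>t) \<bullet> A\<close> divided by a product of normalising factors.
  The normalising factor of period \<open>t\<close> depends only on the pair \<open>(w\<^sub>t, \<pi>\<^sub>t)\<close>, so (ii) makes the
  denominators of the two probabilities equal (at \<open>t = 1\<close> the histories coincide), while (i)
  cancels the terms in \<open>A\<close> of the numerators.
\<close>

lemma logit_index_first: "logit_index \<pi> \<theta> y0 x 1 = logit_index \<pi> \<theta> y0 x' 1"
  by (simp add: logit_index_def history_def)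

text \<open>In a commutative monoid a product depends only on the multiset of the values that
  \<open>h\<close> is applied to.\<close>

lemma prod_eq_if_mset_map_eq:
  fixes h :: "'b \<Rightarrow> 'c::comm_monoid_mult"
  assumes "mset (map f [m..<n]) = mset (map g [m..<n])"
  shows "(\<Prod>t\<in>{m..<n}. h (f t)) = (\<Prod>t\<in>{m..<n}. h (g t))"
proof -
  have *: "(\<Prod>t\<in>{m..<n}. h (k t)) = prod_mset (image_mset h (mset (map k [m..<n])))" for k
    by (simp add: prod_unfold_prod_mset image_mset.compositionality comp_def)
  show ?thesis
    unfolding * assms ..
qed

text \<open>Linearity of the inner product gathers the terms in \<open>A\<close> into a single one,
  the form in which (i) applies.\<close>

lemma prod_logit_eq:
  fixes w :: "nat \<Rightarrow> 'a::real_inner" and p :: "nat \<Rightarrow> real"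
  shows "(\<Prod>t\<in>S. exp (p t + w t \<bullet> A) ^ x t / (1 + exp (p t + w t \<bullet> A))) =
    exp ((\<Sum>t\<in>S. real (x t) * p t) + (\<Sum>t\<in>S. real (x t) *\<^sub>R w t) \<bullet> A) /
    (\<Prod>t\<in>S. 1 + exp (p t + w t \<bullet> A))"
proof (cases "finite S")
  case True
  then show ?thesis
    by (simp add: prod_dividef exp_of_nat_mult[symmetric] exp_sum[symmetric]
        distrib_left sum.distrib inner_sum_left)
\<comment> \<open>For infinite \<open>S\<close> the sums default to 0 and the products to 1, so both
  sides are 1.\<close>
qed simp

theorem lemma2:
  fixes T :: nat
    and w :: "nat \<Rightarrow> real ^ 'd"
    and \<pi> :: "nat \<Rightarrow> nat list \<times> 'z \<Rightarrow> 'p \<Rightarrow> real"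
    and \<theta> :: 'p
    and y0 :: 'z
    and M :: "'z \<Rightarrow> real ^ 'd \<Rightarrow> 'w measure"
    and Y :: "nat \<Rightarrow> 'w \<Rightarrow> nat"
    and y y' :: "nat \<Rightarrow> nat"
  assumes "T \<ge> 1"
    and "\<And>A. prob_space (M y0 A)"
    and "\<And>A t. t \<in> {1..T} \<Longrightarrow> Y t \<in> measurable (M y0 A) (count_space {0, 1})"
    and "\<And>A x. x \<in> binary_seqs T \<Longrightarrow>
           outcome_prob M Y T y0 A x =
             (\<Prod>t=1..T. exp (logit_index \<pi> \<theta> y0 x t + w t \<bullet> A) ^ x t /
                        (1 + exp (logit_index \<pi> \<theta> y0 x t + w t \<bullet> A)))"
    and "y \<in> binary_seqs T" and "y' \<in> binary_seqs T"
    and "(\<Sum>t=1..T. real (y t) *\<^sub>R w t) = (\<Sum>t=1..T. real (y' t) *\<^sub>R w t)"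
    and "mset (map (\<lambda>t. (w t, logit_index \<pi> \<theta> y0 y t)) [2..<Suc T]) =
         mset (map (\<lambda>t. (w t, logit_index \<pi> \<theta> y0 y' t)) [2..<Suc T])"
  shows "(\<forall>A. outcome_prob M Y T y0 A y / outcome_prob M Y T y0 A y' =
            exp (\<Sum>t=1..T. real (y t) * logit_index \<pi> \<theta> y0 y t
                         - real (y' t) * logit_index \<pi> \<theta> y0 y' t)) \<and>
         (\<forall>A B. outcome_prob M Y T y0 A y / outcome_prob M Y T y0 A y' =
                outcome_prob M Y T y0 B y / outcome_prob M Y T y0 B y')"
proof -
  let ?p = "logit_index \<pi> \<theta> y0"
  define D where "D x A = (\<Prod>t=1..T. 1 + exp (?p x t + w t \<bullet> A))" for x A
  have prob: "outcome_prob M Y T y0 A x =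
      exp ((\<Sum>t=1..T. real (x t) * ?p x t) + (\<Sum>t=1..T. real (x t) *\<^sub>R w t) \<bullet> A) / D x A"
    if "x \<in> binary_seqs T" for x A
    unfolding assms(4)[OF that] D_def by (rule prod_logit_eq)
  \<comment> \<open>Period 1 is split off because (ii) only covers periods from 2 on.\<close>
  have D_split: "D x A = (1 + exp (?p x 1 + w 1 \<bullet> A)) *
      (\<Prod>t\<in>{2..<Suc T}. 1 + exp (?p x t + w t \<bullet> A))" for x A
    using \<open>T \<ge> 1\<close> unfolding D_def
    by (simp add: prod.atLeast_Suc_atMost atLeastLessThanSuc_atLeastAtMost numeral_2_eq_2)
  have D_eq: "D y A = D y' A" for A
    using prod_eq_if_mset_map_eq[OF assms(8), of "\<lambda>(v, p). 1 + exp (p + v \<bullet> A)"]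
    unfolding D_split logit_index_first[of \<pi> \<theta> y0 y y'] by simp
  \<comment> \<open>Needed to cancel the common denominator, since division by 0 yields 0.\<close>
  have D_nonzero: "D x A \<noteq> 0" for x A
    unfolding D_def by (rule less_imp_neq[THEN not_sym], rule prod_pos) (simp add: add_pos_pos)
  have "outcome_prob M Y T y0 A y / outcome_prob M Y T y0 A y' =
      exp (\<Sum>t=1..T. real (y t) * ?p y t - real (y' t) * ?p y' t)" for A
    using D_nonzero[of y' A]
    unfolding prob[OF assms(5)] prob[OF assms(6)] assms(7) D_eq
    by (simp add: sum_subtractf exp_add exp_diff)
  \<comment> \<open>The closed form is free of \<open>A\<close>, so the ratios at \<open>A\<close>
    and \<open>B\<close> agree.\<close>
  then show ?thesis
    by simp
qed

end
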